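(* Let $k \geq 1$ be an integer and, for $n \geq k+1$, let $z^k_n \in Z_k Q_n$ be the alternating-block cycle defined in the context. Then there is a constant $\omega_k > 0$, depending only on $k$, such that for all $n \geq k+1$ $$\mathrm{Fill}(z^k_n) \geq \omega_k \lVert z^k_n \rVert^{\frac{k+1}{k}}.$$ Moreover, for every $\epsilon > 0$ there is $N$ such that for all $n \geq N$ $$\mathrm{Fill}(z^k_n) \geq \frac{\sqrt[k]{k!}}{2^{\frac{k+1}{k}}(k+1)}\,(1-\epsilon)\, \lVert z^k_n \rVert^{\frac{k+1}{k}}.$$
   Context: $Q_n$ denotes the $n$-dimensional cube, regarded as a cell complex whose $k$-dimensional faces are the strings of length $n$ over $\{0,1,*\}$ with exactly $k$ entries equal to $*$ (the varying coordinates). $Q_n^{(k)}$ is the set of $k$-dimensional faces. The space of $k$-chains is $C_k Q_n = \{\text{functions } Q_n^{(k)} \to \mathbb{Z}_2\}$, where $\mathbb{Z}_2 = \mathbb{Z}/2\mathbb{Z}$; a set of $k$-faces is identified with its indicator function. The boundary map $\partial : C_k Q_n \to C_{k-1} Q_n$ is the $\mathbb{Z}_2$-linear map sending a single $k$-face to the sum of the $2k$ $(k-1)$-faces obtained by replacing one of its $k$ entries $*$ by $0$ or by $1$. The space of $k$-cycles is $Z_k Q_n = \ker(\partial : C_k Q_n \to C_{k-1} Q_n)$. The norm is the Hamming norm $\lVert y \rVert = |\operatorname{supp} y|$. For $z \in Z_k Q_n$, $$\mathrm{Fill}(z) = \min\{\lVert y \rVert : y \in C_{k+1} Q_n,\ \partial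 y = z\}.$$ The chain $z^k_n$ is the set of all $k$-faces $(a_1,\dots,a_n) \in \{0,1,*\}^n$ of the following form: there are indices $1 \leq i_1 < \dots < i_k \leq n$ with $a_{i_1} = \dots = a_{i_k} = *$, and, setting $i_0 = 0$ and $i_{k+1} = n+1$, there is $\eta \in \{0,1\}$ such that for every $0 \leq j \leq k$ and every $i$ with $i_j < i < i_{j+1}$ one has $a_i \equiv \eta + j \pmod 2$. That is, entries are constant on each block between consecutive varying coordinates, and the constant switches each time a varying coordinate is passed (also when blocks are empty). For example, $(0,0,*,1,*,0,*,1,1,1)$ and $(1,*,*,1,1,1,*,0,0,0)$ belong to $z^3_{10}$. The chain $z^k_n$ is a cycle. *)

theory Defs
  imports Complex_Main "HOL-Library.Z2"
begin

text \<open>The type \<^typ>\<open>bit\<close> of \<^theory>\<open>HOL-Library.Z2\<close> is the two-element field. It serves both as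
  the coefficient ring of chains and as the set of values of the non-varying coordinates.\<close>

datatype coord = Const bit | Star

type_synonym face = "coord list"

definition stars :: "face \<Rightarrow> nat set" where
  "stars a = {i. i < length a \<and> a ! i = Star}"

definition faces :: "nat \<Rightarrow> nat \<Rightarrow> face set" where
  "faces n k = {a. length a = n \<and> card (stars a) = k}"

text \<open>A \<open>k\<close>-chain of \<open>Q\<^sub>n\<close> is a function on the \<open>k\<close>-faces; it is represented by its extension by
  zero to all lists, so that equality of chains is equality of functions.\<close>

type_synonym chain = "face \<Rightarrow> bit"

definition chains :: "nat \<Rightarrow> nat \<Rightarrow> chain set" where
  "chains n k = {y. \<forall>a. a \<notin> faces n k \<longrightarrow> y a = 0}"

definition indicator_chain :: "face set \<Rightarrow> chain" where
  "indicator_chain A = (\<lambda>a. of_bool (a \<in> A))"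

definition face_boundary :: "face \<Rightarrow> chain" where
  "face_boundary a = (\<lambda>b. \<Sum>i\<in>stars a.
     indicator_chain {a[i := Const 0]} b + indicator_chain {a[i := Const 1]} b)"

definition boundary :: "nat \<Rightarrow> nat \<Rightarrow> chain \<Rightarrow> chain" where
  "boundary n k y = (\<lambda>b. \<Sum>a\<in>faces n k. y a * face_boundary a b)"

definition cycles :: "nat \<Rightarrow> nat \<Rightarrow> chain set" where
  "cycles n k = {z \<in> chains n k. boundary n k z = (\<lambda>_. 0)}"

definition hamming_norm :: "chain \<Rightarrow> nat" where
  "hamming_norm y = card {a. y a \<noteq> 0}"

text \<open>The minimum is taken over a finite set, which is nonempty whenever \<open>1 \<le> k\<close> and
  \<open>z \<in> cycles n k\<close>, because the cube is contractible.\<close>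

definition Fill :: "nat \<Rightarrow> nat \<Rightarrow> chain \<Rightarrow> nat" where
  "Fill n k z = Min {hamming_norm y | y. y \<in> chains n (k + 1) \<and> boundary n (k + 1) y = z}"

text \<open>The positions \<open>p 1 < \<dots> < p k\<close> of the varying coordinates are counted from 1, with sentinels
  \<open>p 0 = 0\<close> and \<open>p (k + 1) = n + 1\<close>; the \<open>i\<close>-th coordinate is therefore \<open>a ! (i - 1)\<close>. The sum
  \<open>\<eta> + of_nat j\<close> is computed in \<^typ>\<open>bit\<close>, i.e. modulo 2.\<close>

definition alternating_faces :: "nat \<Rightarrow> nat \<Rightarrow> face set" where
  "alternating_faces n k = {a \<in> faces n k.
     \<exists>p :: nat \<Rightarrow> nat. strict_mono_on {0..k + 1} p \<and> p 0 = 0 \<and> p (k + 1) = n + 1 \<and>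
       (\<forall>j\<in>{1..k}. a ! (p j - 1) = Star) \<and>
       (\<exists>\<eta> :: bit. \<forall>j\<le>k. \<forall>i. p j < i \<and> i < p (j + 1) \<longrightarrow> a ! (i - 1) = Const (\<eta> + of_nat j))}"

definition z_chain :: "nat \<Rightarrow> nat \<Rightarrow> chain" where
  "z_chain n k = indicator_chain (alternating_faces n k)"

end

theory Submission
  imports Defs "HOL-Library.Infinite_Set"
begin

text \<open>For a set \<open>S\<close> of \<open>k + 1\<close> directions, the coordinate projection of \<open>Q\<^sub>n\<close> to the
  \<open>(k + 1)\<close>-cube spanned by \<open>S\<close> maps \<open>z\<^sup>k\<^sub>n\<close> to the full boundary of that cube. Every filling of
  \<open>z\<^sup>k\<^sub>n\<close> is therefore mapped to the top cell, so it contains an odd number of faces with set of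
  directions \<open>S\<close>. Hence \<open>Fill z\<^sup>k\<^sub>n \<ge> n choose (k + 1)\<close>, to be compared with
  \<open>\<parallel>z\<^sup>k\<^sub>n\<parallel> \<le> 2 (n choose k)\<close>. That a filling exists at all is witnessed by the half of
  \<open>z\<^sup>k\<^sup>+\<^sup>1\<^sub>n\<close> with first block 0.\<close>

text \<open>Keeps arithmetic on \<open>bit\<close> in ring form and sums of indicators as sums;
  these rewrites would turn them into bit operations and cardinalities.\<close>

declare add_bit_eq_xor [simp del] mult_bit_eq_and [simp del] sum_of_bool_eq [simp del]

section \<open>Bits, star positions and finiteness\<close>

lemma bit_eq_or: "(c::bit) = \<eta> \<or> c = \<eta> + 1"
  by (cases c; cases \<eta>) auto

lemma UNIV_bit: "(UNIV :: bit set) = {0, 1}"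
  using bit_eq_or[of _ 0] by auto

lemma stars_Nil [simp]: "stars [] = {}"
  by (simp add: stars_def)

lemma stars_Cons: "stars (x # a) = (if x = Star then {0} else {}) \<union> Suc ` stars a"
proof (rule set_eqI)
  fix i show "i \<in> stars (x # a) \<longleftrightarrow> i \<in> (if x = Star then {0} else {}) \<union> Suc ` stars a"
    by (cases i) (auto simp: stars_def)
qed

lemma finite_stars [simp]: "finite (stars a)"
  by (simp add: stars_def)

lemma stars_subset: "stars a \<subseteq> {..<length a}"
  by (auto simp: stars_def)

lemma stars_update_Star: "i < length b \<Longrightarrow> stars (b[i := Star]) = insert i (stars b)"
  by (auto simp: stars_def nth_list_update)

lemma finite_coord [simp]: "finite (UNIV :: coord set)"
proof (rule finite_subset)
  show "UNIV \<subseteq> insert Star (range Const)"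
    using coord.exhaust by blast
qed (simp add: UNIV_bit)

lemma finite_length_faces: "finite {a :: face. length a = n}"
  using finite_lists_length_eq[OF finite_coord, of n] by simp

lemma finite_faces [simp]: "finite (faces n k)"
  by (rule finite_subset[OF _ finite_length_faces[of n]]) (auto simp: faces_def)

section \<open>The boundary as a sum over cofaces\<close>

text \<open>Transposes the incidence relation: for \<open>i\<close> in \<open>stars a\<close>,
  \<open>b\<close> is a facet of \<open>a\<close> in direction \<open>i\<close> exactly when
  \<open>b ! i\<close> is constant and \<open>a = b[i := Star]\<close>. Cofaces of the wrong
  dimension drop out because \<open>y\<close> vanishes there.\<close>

lemma boundary_eq_coface_sum:
  assumes y: "y \<in> chains n k" and b: "length b = n"
  shows "boundary n k y b = (\<Sum>i\<in>{..<n} - stars b. y (b[i := Star]))"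
proof -
  have fb: "face_boundary a b = (\<Sum>i\<in>{..<n} - stars b. of_bool (a = b[i := Star]))"
    if a: "a \<in> faces n k" for a
  proof -
    have la: "length a = n" using a by (simp add: faces_def)
    have "face_boundary a b = (\<Sum>i\<in>stars a. of_bool (i \<notin> stars b \<and> a = b[i := Star]))"
      unfolding face_boundary_def indicator_chain_def
    proof (rule sum.cong[OF refl])
      fix i assume i: "i \<in> stars a"
      have il: "i < n" and ai: "a ! i = Star" using i la by (auto simp: stars_def)
      have *: "b = a[i := Const c] \<longleftrightarrow> b ! i = Const c \<and> a = b[i := Star]" for c
      proof
        assume "b = a[i := Const c]"
        then show "b ! i = Const c \<and> a = b[i := Star]"
          using il la ai by (metis list_update_id list_update_overwrite nth_list_update_eq)
      next
        assume "b ! i = Const c \<and> a = b[i := Star]"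
        then show "b = a[i := Const c]" by (metis list_update_id list_update_overwrite)
      qed
      have s: "i \<notin> stars b \<longleftrightarrow> b ! i = Const 0 \<or> b ! i = Const 1"
        using il b by (cases "b ! i") (auto simp: stars_def)
      \<comment> \<open>The two facets in direction \<open>i\<close> differ, so at most one
        indicator is 1; \<open>b ! i\<close> decides which.\<close>
      show "of_bool (b \<in> {a[i := Const 0]}) + of_bool (b \<in> {a[i := Const 1]})
          = (of_bool (i \<notin> stars b \<and> a = b[i := Star]) :: bit)"
        by (auto simp: * s)
    qed
    also have "\<dots> = (\<Sum>i\<in>{..<n}. of_bool (i \<notin> stars b \<and> a = b[i := Star]))"
      by (rule sum.mono_neutral_left) (use la b in \<open>auto simp: stars_def\<close>)
    also have "\<dots> = (\<Sum>i\<in>{..<n} - stars b. of_bool (a = b[i := Star]))"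
      by (rule sum.mono_neutral_cong_right) auto
    finally show ?thesis .
  qed
  have "boundary n k y b
      = (\<Sum>a\<in>faces n k. \<Sum>i\<in>{..<n} - stars b. y a * of_bool (a = b[i := Star]))"
    unfolding boundary_def by (rule sum.cong) (simp_all add: fb sum_distrib_left)
  also have "\<dots> = (\<Sum>i\<in>{..<n} - stars b. \<Sum>a\<in>faces n k. y a * of_bool (a = b[i := Star]))"
    by (rule sum.swap)
  also have "\<dots> = (\<Sum>i\<in>{..<n} - stars b. y (b[i := Star]))"
    using y by (intro sum.cong refl) (auto simp: chains_def Int_insert_right)
  finally show ?thesis .
qed

lemma boundary_eq_0_if_length:
  assumes "length b \<noteq> n"
  shows "boundary n k y b = 0"
  unfolding boundary_def face_boundary_def indicator_chain_def
  by (intro sum.neutral ballI) (use assms in \<open>auto simp: faces_def intro!: sum.neutral\<close>)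

section \<open>Alternating words and their coface sums\<close>

text \<open>Recursive form of the block condition, which permits induction on the word:
  \<open>\<eta>\<close> is the constant expected next and flips at each \<open>Star\<close>.\<close>

fun alternates :: "bit \<Rightarrow> face \<Rightarrow> bool" where
  "alternates \<eta> [] = True"
| "alternates \<eta> (Star # a) = alternates (\<eta> + 1) a"
| "alternates \<eta> (Const c # a) = (c = \<eta> \<and> alternates \<eta> a)"

lemma bit_add_self: "(c::bit) + c = 0" "(c::bit) + 1 + 1 = c" "(c::bit) + (c + d) = d" "c \<noteq> c + 1"
  by (cases c; cases d; simp)+

lemma coface_sum_Cons:
  fixes y :: chain
  shows "(\<Sum>i\<in>{..<length (x # b)} - stars (x # b). y ((x # b)[i := Star]))
    = (if x = Star then 0 else y (Star # b)) + (\<Sum>i\<in>{..<length b} - stars b. y (x # b[i := Star]))"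
proof -
  have *: "{..<length (x # b)} - stars (x # b)
      = (if x = Star then {} else {0}) \<union> Suc ` ({..<length b} - stars b)"
    by (auto simp: stars_Cons lessThan_Suc_eq_insert_0)
  show ?thesis
    unfolding * by (subst sum.union_disjoint) (auto simp: sum.reindex)
qed

text \<open>A telescoping sum: \<open>Star\<close> at \<open>i\<close> asks for pattern
  \<open>\<eta>\<close> before \<open>i\<close> and pattern \<open>\<eta> + 1\<close> after it, and
  the constant \<open>b ! i\<close> fits exactly one of the two, so modulo 2 each term is a sum of
  two consecutive switch-over indicators. Consequently the half of \<open>z^(k+1)\<close> with first
  block \<open>\<eta>\<close> has as boundary the sum of both halves of \<open>z^k\<close>.\<close>

lemma coface_sum_alternates:
  "(\<Sum>i\<in>{..<length b} - stars b. of_bool (alternates \<eta> (b[i := Star])))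
    = (of_bool (alternates \<eta> b) + of_bool (alternates (\<eta> + 1) b) :: bit)"
proof (induction b arbitrary: \<eta>)
  case Nil
  then show ?case by simp
next
  case (Cons x b)
  show ?case
  proof (cases x)
    case Star
    then show ?thesis
      by (subst coface_sum_Cons[where y = "\<lambda>b. of_bool (alternates \<eta> b)"]) (simp add: Cons.IH)
  next
    case (Const c)
    show ?thesis
      \<comment> \<open>If \<open>c = \<eta>\<close>, the coface \<open>Star # b\<close> cancels one
        of the two terms of the tail sum; if \<open>c = \<eta> + 1\<close>, the tail sum vanishes
        and only \<open>Star # b\<close> is left.\<close>
      using bit_eq_or[of c \<eta>] Const
      by (subst coface_sum_Cons[where y = "\<lambda>b. of_bool (alternates \<eta> b)"])
         (auto simp: Cons.IH bit_add_self)
  qed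
qed

text \<open>The expected constant has flipped once per star passed, which turns the recursion into a
  condition on positions.\<close>

lemma alternates_iff:
  "alternates \<eta> a \<longleftrightarrow>
     (\<forall>i<length a. i \<notin> stars a \<longrightarrow> a ! i = Const (\<eta> + of_nat (card (stars a \<inter> {..<i}))))"
proof (induction a arbitrary: \<eta>)
  case Nil
  then show ?case by simp
next
  case (Cons x a)
  have *: "card (stars (x # a) \<inter> {..<Suc i})
      = (if x = Star then 1 else 0) + card (stars a \<inter> {..<i})" for x i
  proof -
    have eq: "stars (x # a) \<inter> {..<Suc i}
        = (if x = Star then {0} else {}) \<union> Suc ` (stars a \<inter> {..<i})"
      by (auto simp: stars_Cons)
    show ?thesis unfolding eq by (auto simp: card_image)
  qed
  have m: "Suc i \<in> stars (x # a) \<longleftrightarrow> i \<in> stars a" for x i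
    by (auto simp: stars_Cons)
  have z: "0 \<in> stars (x # a) \<longleftrightarrow> x = Star" for x
    by (auto simp: stars_Cons)
  show ?case
    by (cases x) (auto simp: All_less_Suc2 Cons.IH * m z add.assoc)
qed

text \<open>A constant entry fits only one of the two patterns, so the two halves of the cycle can
  share only the all-star word. For \<open>k < n\<close> their union is thus their sum modulo
  2.\<close>

lemma alternates_both:
  assumes "alternates \<eta> b" "alternates (\<eta> + 1) b"
  shows "card (stars b) = length b"
  using assms
proof (induction b arbitrary: \<eta>)
  case Nil
  then show ?case by simp
next
  case (Cons x b)
  then show ?case
    by (cases x) (auto simp: stars_Cons card_image)
qed

definition alternating_face :: "nat \<Rightarrow> bit \<Rightarrow> nat set \<Rightarrow> face" where
  "alternating_face n \<eta> S =
     map (\<lambda>i. if i \<in> S then Star else Const (\<eta> + of_nat (card (S \<inter> {..<i})))) [0..<n]"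

lemma length_alternating_face [simp]: "length (alternating_face n \<eta> S) = n"
  by (simp add: alternating_face_def)

lemma stars_alternating_face [simp]: "S \<subseteq> {..<n} \<Longrightarrow> stars (alternating_face n \<eta> S) = S"
  by (auto simp: alternating_face_def stars_def split: if_splits)

text \<open>A face of the cycle is determined by its first constant and its directions. This bounds
  the number of faces and later singles out one face over a given facet.\<close>

lemma alternates_iff_alternating_face:
  "alternates \<eta> a \<longleftrightarrow> a = alternating_face (length a) \<eta> (stars a)"
  unfolding alternates_iff list_eq_iff_nth_eq
  by (auto simp: alternating_face_def stars_def)

section \<open>Agreement with the block definition\<close>

text \<open>A discrete intermediate value argument; it finds the block that contains a given
  constant coordinate.\<close>

lemma ex_bracketing_index:
  fixes p :: "nat \<Rightarrow> nat"
  assumes "p 0 < x" "x < p (k + 1)" "\<And>j. j \<in> {1..k} \<Longrightarrow> p j \<noteq> x"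
  obtains j where "j \<le> k" "p j < x" "x < p (j + 1)"
  using assms
proof (induction k arbitrary: thesis)
  case 0
  then show ?case by auto
next
  case (Suc k)
  show ?case
  proof (cases "x < p (k + 1)")
    case True
    then obtain j where "j \<le> k" "p j < x" "x < p (j + 1)"
      using Suc.IH Suc.prems by (metis atLeastAtMost_iff le_Suc_eq)
    then show ?thesis using Suc.prems(1)[of j] by simp
  next
    case False
    then have "p (Suc k) < x" using Suc.prems(4)[of "Suc k"] by simp
    then show ?thesis using Suc.prems by auto
  qed
qed

text \<open>The block index of a constant coordinate is the number of stars before it. Forwards,
  \<open>p\<close> is shown to list the stars; backwards, \<open>p\<close> is built from their
  increasing enumeration.\<close>

lemma alternating_faces_eq:
  "alternating_faces n k = {a \<in> faces n k. \<exists>\<eta>. alternates \<eta> a}"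
proof (intro set_eqI iffI)
  fix a assume "a \<in> alternating_faces n k"
  then obtain p :: "nat \<Rightarrow> nat" and \<eta> :: bit where a: "a \<in> faces n k"
    and p: "strict_mono_on {0..k + 1} p" "p 0 = 0" "p (k + 1) = n + 1"
    and ps: "\<And>j. j \<in> {1..k} \<Longrightarrow> a ! (p j - 1) = Star"
    and \<eta>: "\<And>j i. j \<le> k \<Longrightarrow> p j < i \<Longrightarrow> i < p (j + 1) \<Longrightarrow> a ! (i - 1) = Const (\<eta> + of_nat j)"
    unfolding alternating_faces_def by blast
  have la: "length a = n" and ca: "card (stars a) = k" using a by (auto simp: faces_def)
  have less: "p i < p j \<longleftrightarrow> i < j" if "i \<le> k + 1" "j \<le> k + 1" for i j
    using p(1) that by (intro strict_mono_on_less) auto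
  have bnd: "0 < p j \<and> p j < n + 1" if "j \<in> {1..k}" for j
    using less[of 0 j] less[of j "k + 1"] p that by auto
  have inj: "inj_on (\<lambda>j. p j - 1) {1..k}"
  proof (rule inj_onI)
    fix i j assume *: "i \<in> {1..k}" "j \<in> {1..k}" "p i - 1 = p j - 1"
    then have "p i = p j" using bnd[of i] bnd[of j] by auto
    then show "i = j" using less[of i j] less[of j i] * by auto
  qed
  \<comment> \<open>The \<open>k\<close> values \<open>p j - 1\<close> are distinct stars, and
    \<open>a\<close> has only \<open>k\<close> stars.\<close>
  have "(\<lambda>j. p j - 1) ` {1..k} = stars a"
  proof (rule card_subset_eq)
    show "(\<lambda>j. p j - 1) ` {1..k} \<subseteq> stars a"
      using ps bnd la by (fastforce simp: stars_def)
    show "card ((\<lambda>j. p j - 1) ` {1..k}) = card (stars a)"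
      unfolding card_image[OF inj] ca by simp
  qed simp
  then have st: "stars a = (\<lambda>j. p j - 1) ` {1..k}" by simp
  have "alternates \<eta> a"
    unfolding alternates_iff
  proof (intro allI impI)
    fix i assume i: "i < length a" "i \<notin> stars a"
    have ne: "p j \<noteq> Suc i" if "j \<in> {1..k}" for j
    proof
      assume "p j = Suc i"
      then have "i = p j - 1" by simp
      then show False using i(2) that unfolding st by blast
    qed
    \<comment> \<open>List index \<open>i\<close> is coordinate \<open>Suc i\<close> in the count
      from 1 used by \<open>p\<close>.\<close>
    obtain j where j: "j \<le> k" "p j < Suc i" "Suc i < p (j + 1)"
      by (rule ex_bracketing_index[of p "Suc i" k]) (use i la p ne in auto)
    have "stars a \<inter> {..<i} = (\<lambda>j. p j - 1) ` {1..j}"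
    proof -
      have "p l - 1 < i \<longleftrightarrow> l \<le> j" if l: "l \<in> {1..k}" for l
      proof
        assume "p l - 1 < i"
        then have "p l < p (j + 1)" using j by simp
        then show "l \<le> j" using less[of l "j + 1"] l j by simp
      next
        assume "l \<le> j"
        then have "p l \<le> p j" using less[of j l] l j by (metis atLeastAtMost_iff le_SucI Suc_eq_plus1 not_less)
        then show "p l - 1 < i" using j(2) bnd[OF l] by linarith
      qed
      then show ?thesis using j(1) by (auto simp: st)
    qed
    moreover have "inj_on (\<lambda>j. p j - 1) {1..j}"
      using inj by (rule inj_on_subset) (use j in auto)
    ultimately have "card (stars a \<inter> {..<i}) = j" by (simp add: card_image)
    then show "a ! i = Const (\<eta> + of_nat (card (stars a \<inter> {..<i})))"
      using \<eta>[OF j] by simp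
  qed
  then show "a \<in> {a \<in> faces n k. \<exists>\<eta>. alternates \<eta> a}" using a by auto
next
  fix a assume "a \<in> {a \<in> faces n k. \<exists>\<eta>. alternates \<eta> a}"
  then obtain \<eta> where a: "a \<in> faces n k" and alt: "alternates \<eta> a" by auto
  have la: "length a = n" and ca: "card (stars a) = k" using a by (auto simp: faces_def)
  define e where "e = enumerate (stars a)"
  \<comment> \<open>\<open>enumerate\<close> counts the stars from 0 and yields list indices from 0,
    hence both the \<open>j - 1\<close> and the \<open>Suc\<close>; the sentinels are set
    separately.\<close>
  define p where "p j = (if j = 0 then 0 else if j = k + 1 then n + 1 else Suc (e (j - 1)))" for j
  have e_in: "e j \<in> stars a" if "j < k" for j
    using that ca by (auto simp: e_def intro: finite_enumerate_in_set)
  have e_mono: "e i < e j \<longleftrightarrow> i < j" if "i < k" "j < k" for i j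
    using that ca by (simp add: e_def finite_enumerate_mono_iff)
  have e_le: "e i \<le> e j" if "i \<le> j" "j < k" for i j
    using that e_mono[of j i] by (meson le_less_trans not_less)
  have e_bnd: "e j < n" if "j < k" for j
    using e_in[OF that] la by (simp add: stars_def)
  have e_ex: "\<exists>j<k. e j = i" if "i \<in> stars a" for i
    using finite_enumerate_Ex[of "stars a" i] that ca by (auto simp: e_def)
  have "a \<in> alternating_faces n k"
    unfolding alternating_faces_def
  proof (intro CollectI conjI exI[of _ p] exI[of _ \<eta>] allI impI ballI)
    show "strict_mono_on {0..k + 1} p"
    proof (rule strict_mono_onI)
      fix r s assume "r \<in> {0..k + 1}" "s \<in> {0..k + 1}" "r < s"
      then show "p r < p s"
        using e_bnd[of "r - 1"] e_mono[of "r - 1" "s - 1"] by (auto simp: p_def)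
    qed
  next
    fix j assume "j \<in> {1..k}"
    then show "a ! (p j - 1) = Star"
      using e_in[of "j - 1"] by (auto simp: p_def stars_def)
  next
    fix j i assume j: "j \<le> k" and i: "p j < i \<and> i < p (j + 1)"
    have i0: "i - 1 < n" "i > 0" using i j e_bnd[of j] by (auto simp: p_def split: if_splits)
    \<comment> \<open>Exactly the stars \<open>e 0, ..., e (j - 1)\<close> precede index
      \<open>i - 1\<close>, and none sits at it.\<close>
    have *: "e l < i - 1 \<longleftrightarrow> l < j" "e l \<noteq> i - 1" if l: "l < k" for l
    proof -
      have A: "e l < i - 1" if "l < j"
      proof -
        have "e l \<le> e (j - 1)" using e_le[of l "j - 1"] that j by linarith
        then show ?thesis using i that j by (auto simp: p_def)
      qed
      moreover have B: "i - 1 < e l" if "j \<le> l"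
      proof -
        have "e j \<le> e l" using e_le[of j l] that l by blast
        then show ?thesis using i i0 that l by (auto simp: p_def)
      qed
      ultimately show "e l < i - 1 \<longleftrightarrow> l < j" "e l \<noteq> i - 1" by force+
    qed
    have "stars a \<inter> {..<i - 1} = e ` {..<j}"
    proof (intro set_eqI iffI)
      fix x assume x: "x \<in> stars a \<inter> {..<i - 1}"
      then obtain l where "l < k" "x = e l" using e_ex by blast
      then show "x \<in> e ` {..<j}" using x *(1)[of l] by auto
    next
      fix x assume "x \<in> e ` {..<j}"
      then obtain l where "l < j" "x = e l" by auto
      then show "x \<in> stars a \<inter> {..<i - 1}" using *(1)[of l] e_in[of l] j by auto
    qed
    moreover have "inj_on e {..<j}"
    proof (rule inj_onI)
      fix x y assume "x \<in> {..<j}" "y \<in> {..<j}" "e x = e y"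
      then show "x = y" using e_mono[of x y] e_mono[of y x] j by auto
    qed
    ultimately have "card (stars a \<inter> {..<i - 1}) = j" by (simp add: card_image)
    moreover have "i - 1 \<notin> stars a" using e_ex *(2) by blast
    ultimately show "a ! (i - 1) = Const (\<eta> + of_nat j)"
      using alt i0 la unfolding alternates_iff by metis
  qed (use a in \<open>auto simp: p_def\<close>)
  then show "a \<in> alternating_faces n k" .
qed

section \<open>Size of the cycle and existence of a filling\<close>

lemma hamming_norm_z_chain_le: "hamming_norm (z_chain n k) \<le> 2 * (n choose k)"
proof -
  let ?P = "{S. S \<subseteq> {..<n} \<and> card S = k}"
  have "{a. z_chain n k a \<noteq> 0} \<subseteq> (\<lambda>(\<eta>, S). alternating_face n \<eta> S) ` (UNIV \<times> ?P)"
  proof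
    fix a assume "a \<in> {a. z_chain n k a \<noteq> 0}"
    then obtain \<eta> where "a \<in> faces n k" "alternates \<eta> a"
      by (auto simp: z_chain_def indicator_chain_def alternating_faces_eq)
    then have "a = alternating_face n \<eta> (stars a)" "stars a \<in> ?P"
      using stars_subset by (auto simp: faces_def alternates_iff_alternating_face)
    then show "a \<in> (\<lambda>(\<eta>, S). alternating_face n \<eta> S) ` (UNIV \<times> ?P)"
      by (intro image_eqI[of _ _ "(\<eta>, stars a)"]) auto
  qed
  moreover have fin: "finite ?P" by (rule finite_subset[of _ "Pow {..<n}"]) auto
  ultimately have "hamming_norm (z_chain n k) \<le> card ((UNIV :: bit set) \<times> ?P)"
    unfolding hamming_norm_def by (intro surj_card_le) (auto simp: UNIV_bit)
  also have "\<dots> = 2 * (n choose k)"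
    unfolding card_cartesian_product UNIV_bit by (simp add: n_subsets)
  finally show ?thesis .
qed

text \<open>Guarantees that the \<open>Min\<close> in \<open>Fill\<close> is taken over a nonempty
  set.\<close>

lemma z_chain_has_filling:
  assumes "k < n"
  shows "\<exists>y\<in>chains n (k + 1). boundary n (k + 1) y = z_chain n k"
proof
  let ?y = "indicator_chain {a \<in> faces n (k + 1). alternates 0 a}"
  show y: "?y \<in> chains n (k + 1)" by (simp add: chains_def indicator_chain_def)
  show "boundary n (k + 1) ?y = z_chain n k"
  proof
    fix b
    show "boundary n (k + 1) ?y b = z_chain n k b"
    proof (cases "length b = n")
      case False
      then show ?thesis
        by (simp add: boundary_eq_0_if_length z_chain_def indicator_chain_def alternating_faces_eq faces_def)
    next
      case True
      have "boundary n (k + 1) ?y b = (\<Sum>i\<in>{..<n} - stars b. ?y (b[i := Star]))"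
        by (rule boundary_eq_coface_sum[OF y True])
      \<comment> \<open>Each new star raises the dimension by one, so the dimension condition does
        not depend on \<open>i\<close> and factors out.\<close>
      also have "\<dots> = (\<Sum>i\<in>{..<length b} - stars b.
          of_bool (card (stars b) = k) * of_bool (alternates 0 (b[i := Star])))"
        by (rule sum.cong) (auto simp: True indicator_chain_def faces_def stars_update_Star)
      also have "\<dots> = of_bool (card (stars b) = k)
          * (of_bool (alternates 0 b) + of_bool (alternates (0 + 1) b))"
        unfolding sum_distrib_left[symmetric] coface_sum_alternates ..
      also have "\<dots> = z_chain n k b"
      \<comment> \<open>Since \<open>k < n\<close>, no \<open>k\<close>-face fits both patterns, so
        the sum modulo 2 is the indicator of the union.\<close>
      proof -
        have "(\<exists>\<eta>. alternates \<eta> b) \<longleftrightarrow> alternates 0 b \<or> alternates 1 b"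
          by (metis add_0 bit_eq_or)
        then show ?thesis
          using alternates_both[of 0 b] True assms
          by (auto simp: z_chain_def indicator_chain_def alternating_faces_eq faces_def)
      qed
      finally show ?thesis .
    qed
  qed
qed

section \<open>Lower bound for fillings\<close>

text \<open>\<open>h\<close> exchanges the part of \<open>A\<close> where \<open>P\<close> holds
  with the rest and preserves \<open>f\<close>, so the two parts have equal sums, which cancel
  modulo 2.\<close>

lemma sum_eq_0_involution:
  fixes f :: "'a \<Rightarrow> bit"
  assumes "finite A" "\<And>x. x \<in> A \<Longrightarrow> h x \<in> A" "\<And>x. x \<in> A \<Longrightarrow> h (h x) = x"
    "\<And>x. x \<in> A \<Longrightarrow> P (h x) \<longleftrightarrow> \<not> P x" "\<And>x. x \<in> A \<Longrightarrow> f (h x) = f x"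
  shows "sum f A = 0"
proof -
  have "sum f A = sum f ({x\<in>A. P x} \<union> {x\<in>A. \<not> P x})"
    by (rule sum.cong) auto
  also have "\<dots> = sum f {x\<in>A. P x} + sum f {x\<in>A. \<not> P x}"
    by (rule sum.union_disjoint) (use assms(1) in auto)
  also have "sum f {x\<in>A. P x} = sum f {x\<in>A. \<not> P x}"
    by (rule sum.reindex_bij_witness[of _ h h]) (use assms in auto)
  finally show ?thesis by (simp add: bit_add_self)
qed

text \<open>Projecting to \<open>S\<close> and evaluating at one facet of the resulting cube amounts to summing over
  the set \<open>B\<close> of the faces with directions \<open>S - {s}\<close> whose coordinate \<open>s\<close> is 0. A coface in a
  direction other than \<open>s\<close> arises from two members of \<open>B\<close> and cancels.\<close>

lemma filling_meets_direction:
  assumes y: "y \<in> chains n (k + 1)" and dy: "boundary n (k + 1) y = z_chain n k"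
    and S: "S \<subseteq> {..<n}" "card S = k + 1"
  shows "\<exists>a. stars a = S \<and> y a \<noteq> 0"
proof -
  obtain s where s: "s \<in> S" using S by (metis Suc_eq_plus1 card_eq_SucD insertI1)
  define T where "T = S - {s}"
  have T: "T \<subseteq> {..<n}" "card T = k" "s \<notin> T" "insert s T = S" "s < n"
    using S s by (auto simp: T_def card_Diff_singleton)
  define B where "B = {b :: face. length b = n \<and> stars b = T \<and> b ! s = Const 0}"
  have finB: "finite B" by (rule finite_subset[OF _ finite_length_faces[of n]]) (auto simp: B_def)
  \<comment> \<open>Coordinate \<open>s\<close> lies in block number
    \<open>card (T \<inter> {..<s})\<close>; for its entry to be 0 the first constant must be that
    number modulo 2. Hence \<open>b0\<close> is the only face of the cycle in
    \<open>B\<close>.\<close>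
  define b0 where "b0 = alternating_face n (of_nat (card (T \<inter> {..<s}))) T"
  have "z_chain n k b = of_bool (b = b0)" if "b \<in> B" for b
  proof -
    have b: "length b = n" "stars b = T" "b ! s = Const 0" using that by (auto simp: B_def)
    have "alternates \<eta> b \<longleftrightarrow> b = b0 \<and> \<eta> = of_nat (card (T \<inter> {..<s}))" for \<eta>
    proof
      assume alt: "alternates \<eta> b"
      then have "b ! s = Const (\<eta> + of_nat (card (T \<inter> {..<s})))"
        using b T unfolding alternates_iff by auto
      then have "\<eta> = of_nat (card (T \<inter> {..<s}))"
        using b bit_eq_or[of \<eta> "of_nat (card (T \<inter> {..<s}))"] by (auto simp: bit_add_self)
      then show "b = b0 \<and> \<eta> = of_nat (card (T \<inter> {..<s}))"
        using alt b by (simp add: alternates_iff_alternating_face b0_def)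
    qed (use b in \<open>auto simp: alternates_iff_alternating_face b0_def\<close>)
    then show ?thesis
      using b T by (auto simp: z_chain_def indicator_chain_def alternating_faces_eq faces_def)
  qed
  then have "(\<Sum>b\<in>B. z_chain n k b) = (\<Sum>b\<in>B. 1 * of_bool (b = b0))" by simp
  also have "\<dots> = 1"
  proof -
    have "b0 \<in> B"
      using T by (auto simp: B_def b0_def bit_add_self) (simp add: alternating_face_def bit_add_self)
    then show ?thesis using finB by (subst sum_mult_of_bool_eq) (auto simp: Int_insert_right)
  qed
  finally have one: "(\<Sum>b\<in>B. z_chain n k b) = 1" .
  have "(\<Sum>b\<in>B. z_chain n k b) = (\<Sum>b\<in>B. \<Sum>i\<in>{..<n} - T. y (b[i := Star]))"
    unfolding dy[symmetric]
  proof (rule sum.cong[OF refl])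
    fix b assume "b \<in> B"
    then have "length b = n" "stars b = T" by (auto simp: B_def)
    then show "boundary n (k + 1) y b = (\<Sum>i\<in>{..<n} - T. y (b[i := Star]))"
      using boundary_eq_coface_sum[OF y] by blast
  qed
  also have "\<dots> = (\<Sum>i\<in>{..<n} - T. \<Sum>b\<in>B. y (b[i := Star]))"
    by (rule sum.swap)
  also have "\<dots> = (\<Sum>i\<in>{s}. \<Sum>b\<in>B. y (b[i := Star]))"
  proof (rule sum.mono_neutral_right)
    show "\<forall>i\<in>{..<n} - T - {s}. (\<Sum>b\<in>B. y (b[i := Star])) = 0"
    proof
      fix i assume i: "i \<in> {..<n} - T - {s}"
      define h where "h b = b[i := (if b ! i = Const 0 then Const 1 else Const 0)]" for b :: face
      have c: "b ! i = Const 0 \<or> b ! i = Const 1" if "b \<in> B" for b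
        using that i bit_eq_or[of _ 0] by (cases "b ! i") (auto simp: B_def stars_def)
      show "(\<Sum>b\<in>B. y (b[i := Star])) = 0"
      proof (rule sum_eq_0_involution[where h = h and P = "\<lambda>b. b ! i = Const 0", OF finB])
        fix b assume b: "b \<in> B"
        have l: "i < length b" using b i by (auto simp: B_def)
        show "h b \<in> B"
          using b i c[OF b] unfolding B_def h_def stars_def
          by (auto simp: nth_list_update split: if_splits)
        show "h (h b) = b"
          using c[OF b] l by (auto simp: h_def list_update_same_conv)
        show "(h b ! i = Const 0) \<longleftrightarrow> \<not> b ! i = Const 0"
          using l by (auto simp: h_def)
        show "y ((h b)[i := Star]) = y (b[i := Star])"
          by (simp add: h_def)
      qed
    qed
  qed (use T in auto)
  finally have "(\<Sum>b\<in>B. y (b[s := Star])) \<noteq> 0" using one by simp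
  then obtain b where "b \<in> B" "y (b[s := Star]) \<noteq> 0"
    by (meson sum.neutral)
  then show ?thesis
    using T by (intro exI[of _ "b[s := Star]"]) (auto simp: B_def stars_update_Star)
qed

lemma finite_chain_support:
  assumes "y \<in> chains n k"
  shows "{a. y a \<noteq> 0} \<subseteq> faces n k" "finite {a. y a \<noteq> 0}"
proof -
  show "{a. y a \<noteq> 0} \<subseteq> faces n k" using assms by (auto simp: chains_def)
  then show "finite {a. y a \<noteq> 0}" by (rule finite_subset) simp
qed

lemma Fill_z_chain_ge:
  assumes "k < n"
  shows "n choose (k + 1) \<le> Fill n k (z_chain n k)"
proof -
  let ?Y = "{hamming_norm y | y. y \<in> chains n (k + 1) \<and> boundary n (k + 1) y = z_chain n k}"
  \<comment> \<open>Norms of \<open>(k + 1)\<close>-chains are bounded by the number of faces, so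
    the minimum is over a finite set and is attained by some \<open>y\<close>.\<close>
  have "?Y \<subseteq> {..card (faces n (k + 1))}"
    using finite_chain_support(1) by (auto simp: hamming_norm_def intro!: card_mono)
  then have "finite ?Y" by (rule finite_subset) simp
  moreover have "?Y \<noteq> {}" using z_chain_has_filling[OF assms] by auto
  ultimately have "Min ?Y \<in> ?Y" by (rule Min_in)
  then obtain y where y: "Fill n k (z_chain n k) = hamming_norm y" "y \<in> chains n (k + 1)"
      "boundary n (k + 1) y = z_chain n k"
    unfolding Fill_def by auto
  have "{S. S \<subseteq> {..<n} \<and> card S = k + 1} \<subseteq> stars ` {a. y a \<noteq> 0}"
  proof
    fix S assume "S \<in> {S. S \<subseteq> {..<n} \<and> card S = k + 1}"
    then obtain a where "stars a = S" "y a \<noteq> 0"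
      using filling_meets_direction[OF y(2,3), of S] by blast
    then show "S \<in> stars ` {a. y a \<noteq> 0}" by blast
  qed
  then have "card {S. S \<subseteq> {..<n} \<and> card S = k + 1} \<le> card {a. y a \<noteq> 0}"
    by (rule surj_card_le[OF finite_chain_support(2)[OF y(2)]])
  then show ?thesis by (simp add: n_subsets y(1) hamming_norm_def)
qed

section \<open>Numerical estimates\<close>

lemma binomial_mult_fact_le: "real (n choose k) * fact k \<le> real n ^ k"
  using binomial_fact_pow[of n k] by (metis of_nat_fact of_nat_le_iff of_nat_mult of_nat_power)

text \<open>With \<open>C = n choose k\<close>, the power of the norm is at most
  \<open>2 powr ((k + 1) / k) * C * root k C\<close>, where
  \<open>root k (fact k) * root k C \<le> n\<close>, while
  \<open>n choose (k + 1) = C * (n - k) / (k + 1)\<close>. Keeping the factor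
  \<open>(n - k) / n\<close> explicit serves both claims: it tends to 1 and stays at least
  \<open>1 / (k + 1)\<close>.\<close>

lemma z_chain_isoperimetric:
  assumes k: "k \<ge> 1" and n: "k < n"
  shows "root k (fact k) / (2 powr (real (k + 1) / real k) * real (k + 1))
      * ((real n - real k) / real n)
      * real (hamming_norm (z_chain n k)) powr (real (k + 1) / real k)
    \<le> real (Fill n k (z_chain n k))"
proof -
  let ?e = "real (k + 1) / real k"
  define C where "C = real (n choose k)"
  have C: "C > 0" using n by (simp add: C_def)
  have "root k (fact k) * root k C = root k (C * fact k)"
    by (simp add: real_root_mult mult.commute)
  also have "\<dots> \<le> root k (real n ^ k)"
    using k binomial_mult_fact_le[of n k] by (simp add: C_def)
  also have "\<dots> = real n" using k by (simp add: real_root_power_cancel)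
  finally have r: "root k (fact k) * root k C \<le> real n" .
  have e: "?e = 1 + 1 / real k" using k by (simp add: field_simps)
  have "real (hamming_norm (z_chain n k)) \<le> 2 * C"
    using hamming_norm_z_chain_le[of n k] unfolding C_def by (metis of_nat_le_iff of_nat_mult of_nat_numeral)
  then have "real (hamming_norm (z_chain n k)) powr ?e \<le> (2 * C) powr ?e"
    by (intro powr_mono2) auto
  also have "\<dots> = 2 powr ?e * (C * root k C)"
  proof -
    have "C powr ?e = C * root k C"
      unfolding e powr_add using C k by (simp add: root_powr_inverse)
    then show ?thesis using C by (simp add: powr_mult)
  qed
  finally have M: "real (hamming_norm (z_chain n k)) powr ?e \<le> 2 powr ?e * (C * root k C)" .
  have "root k (fact k) / (2 powr ?e * real (k + 1)) * ((real n - real k) / real n)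
      * real (hamming_norm (z_chain n k)) powr ?e
    \<le> root k (fact k) / (2 powr ?e * real (k + 1)) * ((real n - real k) / real n)
      * (2 powr ?e * (C * root k C))"
    using n k by (intro mult_left_mono[OF M]) auto
  also have "\<dots> = (root k (fact k) * root k C) * (C * (real n - real k) / (real n * real (k + 1)))"
    by (simp add: mult_ac)
  also have "\<dots> \<le> real n * (C * (real n - real k) / (real n * real (k + 1)))"
    using n C by (intro mult_right_mono[OF r]) auto
  also have "\<dots> = C * (real n - real k) / real (k + 1)" using n by simp
  also have "\<dots> = real (n choose (k + 1))"
  proof -
    have "(k + 1) * (n choose (k + 1)) = (n - k) * (n choose k)"
      using binomial_absorb_comp[of n k] binomial_absorption[of k "n"] n
      by simp
    then have "real (k + 1) * real (n choose (k + 1)) = (real n - real k) * C"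
      unfolding C_def using n by (metis of_nat_mult of_nat_diff less_imp_le)
    then show ?thesis by (simp add: field_simps)
  qed
  also have "\<dots> \<le> real (Fill n k (z_chain n k))" using Fill_z_chain_ge[OF n] by simp
  finally show ?thesis .
qed

theorem corollary5p3:
  fixes k :: nat
  assumes "k \<ge> 1"
  shows "(\<exists>\<omega> :: real. \<omega> > 0 \<and>
           (\<forall>n\<ge>k + 1. real (Fill n k (z_chain n k))
              \<ge> \<omega> * real (hamming_norm (z_chain n k)) powr (real (k + 1) / real k))) \<and>
         (\<forall>\<epsilon> :: real. \<epsilon> > 0 \<longrightarrow>
           (\<exists>N\<ge>k + 1. \<forall>n\<ge>N. real (Fill n k (z_chain n k))
              \<ge> root k (fact k) / (2 powr (real (k + 1) / real k) * real (k + 1)) * (1 - \<epsilon>)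
                 * real (hamming_norm (z_chain n k)) powr (real (k + 1) / real k)))"
proof -
  define c where "c = root k (fact k) / (2 powr (real (k + 1) / real k) * real (k + 1))"
  define M where "M n = real (hamming_norm (z_chain n k)) powr (real (k + 1) / real k)" for n
  have c: "c > 0" using assms by (simp add: c_def)
  \<comment> \<open>Both claims are instances for a suitable \<open>t\<close>, which may be
    negative, as \<open>1 - \<epsilon>\<close> is for large \<open>\<epsilon>\<close>.\<close>
  have bound: "c * t * M n \<le> real (Fill n k (z_chain n k))"
    if "k < n" "t \<le> (real n - real k) / real n" for n t
  proof -
    have "c * t * M n \<le> c * ((real n - real k) / real n) * M n"
      using that c by (intro mult_right_mono mult_left_mono) (auto simp: M_def)
    also have "\<dots> \<le> real (Fill n k (z_chain n k))"
      using z_chain_isoperimetric[OF assms that(1)] by (simp only: c_def M_def)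
    finally show ?thesis .
  qed
  \<comment> \<open>The witness for \<open>\<omega>\<close>: \<open>(n - k) / n\<close> increases
    with \<open>n\<close> and equals \<open>1 / (k + 1)\<close> at \<open>n = k + 1\<close>.\<close>
  have "c * (1 / real (k + 1)) > 0" using c by simp
  moreover have "c * (1 / real (k + 1)) * M n \<le> real (Fill n k (z_chain n k))" if "n \<ge> k + 1" for n
  proof (rule bound)
    show "1 / real (k + 1) \<le> (real n - real k) / real n"
    proof -
      \<comment> \<open>This product is the difference \<open>(n - k) * (k + 1) - n\<close>.\<close>
      have "0 \<le> real k * (real n - real k - 1)" using that by simp
      then have "real n \<le> (real n - real k) * real (k + 1)" by (simp add: algebra_simps)
      then show ?thesis using that by (simp add: divide_simps)
    qed
  qed (use that in simp)
  moreover have "\<exists>N\<ge>k + 1. \<forall>n\<ge>N. c * (1 - \<epsilon>) * M n \<le> real (Fill n k (z_chain n k))"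
    if "\<epsilon> > 0" for \<epsilon>
  \<comment> \<open>\<open>n \<ge> k / \<epsilon>\<close> gives
    \<open>k / n \<le> \<epsilon>\<close>; the maximum with \<open>k + 1\<close> keeps
    \<open>n > k\<close>.\<close>
  proof (intro exI[of _ "max (k + 1) (nat \<lceil>real k / \<epsilon>\<rceil>)"] conjI allI impI)
    fix n assume n: "n \<ge> max (k + 1) (nat \<lceil>real k / \<epsilon>\<rceil>)"
    then have "real k / \<epsilon> \<le> real n" by linarith
    then have "1 - \<epsilon> \<le> (real n - real k) / real n"
      using n that by (simp add: field_simps)
    then show "c * (1 - \<epsilon>) * M n \<le> real (Fill n k (z_chain n k))"
      using n by (intro bound) auto
  qed simp
  ultimately show ?thesis
    unfolding c_def[symmetric] M_def[symmetric] by blast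
qed

end
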